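(* Let $1\le I<N$ be integers. For each $J=1,\dots,I+1$, the numbers $\tau^\circ_J(k,j)$ satisfy $\tau^\circ_J(N,j)=0$ and, for all $1\le k<N$, $$\tau^\circ_J(k,j)=B(k,j)+(k-j+1)\,\tau^\circ_J(k+1,j)+\sum_{i=1}^{j-1}\tau^\circ_J(k+1,i),$$ where $1\le j\le I+1$ is arbitrary when $k>I$, the convention $j=k$ is adopted when $k\le I$, and $$B(k,j)=\begin{cases}\sigma_J(k+1,j) & \text{if } k\neq I,\\ \sigma_J(k+1,k+1) & \text{if } k=I.\end{cases}$$
   Context: Permutations are written as words; $\pi_i$ is the value in position $i$. A bottom-to-top maximum of a permutation is an entry whose position is to the right of the positions of all entries with smaller value. For a permutation $\pi$ of size greater than $I$, the $J$-statistic $J(\pi)$ is the value of the next (leftmost) bottom-to-top maximum in a position greater than $I$; it lies in $\{1,\dots,I+1\}$. It is undefined for permutations of size at most $I$. The flattening of a sequence of $i$ distinct integers is the permutation in $\mathfrak{S}_i$ with the same relative order. A left-to-right maximum is an entry larger than all entries to its left. For a prefix $p\in\mathfrak{S}_k$, $\pi\in\mathfrak{S}_N$ is $p$-acceptable if the flattening of $\pi_1\cdots\pi_k$ equals $p$ and $\pi_k=N$. It is $p$-rejectable if the flattening of $\pi_1\cdots\pi_k$ equals $p$, the value $N$ lies in a position greater than $k$, and there are no left-to-right maxima of $\pi$ in positions strictly between $k$ and the position of $N$. $\sigma_J(k,j)$ is the number of $p$-acceptable $\pi\in\mathfrak{S}_N$ with $J(\pi)=J$, where $p\in\mathfrak{S}_k$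 is any fixed prefix with $p_k=k$ and (when $k>I$) $J(p)=j$. $\tau^\circ_J(k,j)$ is the number of $p$-rejectable $\pi\in\mathfrak{S}_N$ with $J(\pi)=J$, where $p\in\mathfrak{S}_k$ is any fixed prefix with (when $k>I$) $J(p)=j$. These numbers do not depend on the choice of $p$. When $k\le I$ they do not depend on $j$, and the second argument is ignored. *)

theory Defs
  imports Main "HOL-Combinatorics.Multiset_Permutations"
begin

text \<open>
  Permutations of size \<open>n\<close> are words, i.e. lists that contain each of \<open>1, ..., n\<close>
  exactly once. Positions are counted from 1, so position \<open>i\<close> is list index \<open>i - 1\<close>.
\<close>

abbreviation perms :: "nat \<Rightarrow> nat list set" where
  "perms n \<equiv> permutations_of_set {1..n}"

abbreviation entry :: "nat list \<Rightarrow> nat \<Rightarrow> nat" where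
  "entry \<pi> i \<equiv> \<pi> ! (i - 1)"

definition btt_max_at :: "nat list \<Rightarrow> nat \<Rightarrow> bool" where
  "btt_max_at \<pi> i \<longleftrightarrow>
     i \<in> {1..length \<pi>} \<and> (\<forall>l\<in>{1..length \<pi>}. entry \<pi> l < entry \<pi> i \<longrightarrow> l < i)"

definition ltr_max_at :: "nat list \<Rightarrow> nat \<Rightarrow> bool" where
  "ltr_max_at \<pi> i \<longleftrightarrow>
     i \<in> {1..length \<pi>} \<and> (\<forall>l\<in>{1..length \<pi>}. l < i \<longrightarrow> entry \<pi> l < entry \<pi> i)"

text \<open>
  The \<open>J\<close>-statistic. It is meaningful only for permutations of size greater than \<open>I\<close>
  (otherwise the \<open>LEAST\<close> is over an empty set) and is used only for those.
\<close>

definition J_stat :: "nat \<Rightarrow> nat list \<Rightarrow> nat" where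
  "J_stat I \<pi> = entry \<pi> (LEAST i. I < i \<and> btt_max_at \<pi> i)"

definition flattening :: "nat list \<Rightarrow> nat list" where
  "flattening xs = map (\<lambda>x. card {y \<in> set xs. y \<le> x}) xs"

definition acceptable :: "nat \<Rightarrow> nat list \<Rightarrow> nat list \<Rightarrow> bool" where
  "acceptable N p \<pi> \<longleftrightarrow>
     \<pi> \<in> perms N \<and> flattening (take (length p) \<pi>) = p \<and> entry \<pi> (length p) = N"

definition rejectable :: "nat \<Rightarrow> nat list \<Rightarrow> nat list \<Rightarrow> bool" where
  "rejectable N p \<pi> \<longleftrightarrow>
     \<pi> \<in> perms N \<and> flattening (take (length p) \<pi>) = p \<and>
     (\<exists>m. length p < m \<and> m \<le> N \<and> entry \<pi> m = N \<and>
          (\<forall>i. length p < i \<and> i < m \<longrightarrow> \<not> ltr_max_at \<pi> i))"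

text \<open>
  The prefixes of size \<open>k\<close> with parameter \<open>j\<close>. For \<open>k \<le> I\<close> the \<open>J\<close>-statistic of the
  prefix is undefined and \<open>j\<close> is ignored.
\<close>

definition prefixes :: "nat \<Rightarrow> nat \<Rightarrow> nat \<Rightarrow> nat list set" where
  "prefixes I k j = {p \<in> perms k. k > I \<longrightarrow> J_stat I p = j}"

text \<open>
  \<open>sigma I N J k j\<close> and \<open>tau I N J k j\<close> stand for $\sigma_J(k,j)$ and
  $\tau^\circ_J(k,j)$. Each is the common value of a count over all eligible
  prefixes \<open>p\<close>, so a value is determined only if eligible prefixes exist and
  the count is the same for all of them. In particular \<open>sigma I N J (I + 1) j\<close> is meaningful
  only for \<open>j = I + 1\<close>: a prefix of size \<open>I + 1\<close> ending in its maximum has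
  \<open>J\<close>-statistic \<open>I + 1\<close>.
\<close>

definition sigma :: "nat \<Rightarrow> nat \<Rightarrow> nat \<Rightarrow> nat \<Rightarrow> nat \<Rightarrow> nat" where
  "sigma I N J k j =
     (THE n. \<forall>p \<in> prefixes I k j. entry p k = k \<longrightarrow>
        card {\<pi>. acceptable N p \<pi> \<and> J_stat I \<pi> = J} = n)"

definition tau :: "nat \<Rightarrow> nat \<Rightarrow> nat \<Rightarrow> nat \<Rightarrow> nat \<Rightarrow> nat" where
  "tau I N J k j =
     (THE n. \<forall>p \<in> prefixes I k j.
        card {\<pi>. rejectable N p \<pi> \<and> J_stat I \<pi> = J} = n)"

definition B :: "nat \<Rightarrow> nat \<Rightarrow> nat \<Rightarrow> nat \<Rightarrow> nat \<Rightarrow> nat" where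
  "B I N J k j =
     (if k \<noteq> I then sigma I N J (k + 1) j else sigma I N J (k + 1) (k + 1))"

end

theory Submission
  imports Defs "HOL-Library.Infinite_Set"
begin

text \<open>
  The leftmost bottom-to-top maximum in a position greater than \<open>I\<close> is the minimum of the entries
  in those positions, so \<open>J_stat I \<pi> = Min (set (drop I \<pi>))\<close>. For the recursion, split the
  \<open>p\<close>-rejectable \<open>\<pi>\<close> by the flattening \<open>q\<close> of the first \<open>k + 1\<close> entries, which is determined
  by \<open>p\<close> and its last entry \<open>v\<close>. If \<open>v = k + 1\<close>, then position \<open>k + 1\<close> is a left-to-right
  maximum, hence must hold \<open>N\<close>, so \<open>\<pi>\<close> is \<open>q\<close>-acceptable. Otherwise \<open>\<pi>\<close> is
  \<open>q\<close>-rejectable, and \<open>J(q) = min v j\<close>.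
\<close>

section \<open>Flattening and its invariance under order-preserving relabelling\<close>

lemma permsD:
  assumes "p \<in> perms n"
  shows "set p = {1..n}" "distinct p" "length p = n"
proof -
  show 1: "set p = {1..n}" "distinct p"
    using assms by (auto dest: permutations_of_setD)
  show "length p = n"
    using distinct_card[OF 1(2)] 1(1) by simp
qed

lemma flattening_map:
  assumes "strict_mono_on (set xs) f"
  shows "flattening (map f xs) = flattening xs"
proof -
  have "card {y \<in> f ` set xs. y \<le> f x} = card {y \<in> set xs. y \<le> x}" if "x \<in> set xs" for x
  proof -
    have "{y \<in> f ` set xs. y \<le> f x} = f ` {y \<in> set xs. y \<le> x}"
      using strict_mono_on_less_eq[OF assms] that by auto
    moreover have "inj_on f {y \<in> set xs. y \<le> x}"
      using strict_mono_on_imp_inj_on[OF assms] by (rule inj_on_subset) auto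
    ultimately show ?thesis by (simp add: card_image)
  qed
  then show ?thesis by (simp add: flattening_def)
qed

lemma strict_mono_on_rank:
  fixes S :: "nat set"
  assumes "finite S"
  shows "strict_mono_on S (\<lambda>x. card {y \<in> S. y \<le> x})"
proof (rule strict_mono_onI)
  fix a b assume "a \<in> S" "b \<in> S" "a < b"
  then have "{y \<in> S. y \<le> a} \<subset> {y \<in> S. y \<le> b}" by force
  then show "card {y \<in> S. y \<le> a} < card {y \<in> S. y \<le> b}"
    using assms by (intro psubset_card_mono) auto
qed

lemma flattening_in_perms:
  assumes "distinct xs"
  shows "flattening xs \<in> perms (length xs)"
proof -
  let ?r = "\<lambda>x. card {y \<in> set xs. y \<le> x}"
  have inj: "inj_on ?r (set xs)"
    by (rule strict_mono_on_imp_inj_on[OF strict_mono_on_rank]) simp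
  have "?r x \<in> {1..length xs}" if "x \<in> set xs" for x
  proof -
    have "?r x \<le> card (set xs)" by (rule card_mono) auto
    moreover have "{y \<in> set xs. y \<le> x} \<noteq> {}" using that by auto
    ultimately show ?thesis
      using card_length[of xs] by (simp add: Suc_le_eq card_gt_0_iff)
  qed
  then have "?r ` set xs \<subseteq> {1..length xs}" by blast
  then have "?r ` set xs = {1..length xs}"
    using assms inj by (intro card_subset_eq) (auto simp: card_image distinct_card)
  then show ?thesis
    using assms inj by (intro permutations_of_setI) (auto simp: flattening_def distinct_map)
qed

lemma flattening_perms:
  assumes "p \<in> perms n"
  shows "flattening p = p"
proof -
  have "card {y \<in> {1..n}. y \<le> x} = x" if "x \<in> {1..n}" for x
  proof -
    have "{y \<in> {1..n}. y \<le> x} = {1..x}" using that by auto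
    then show ?thesis by simp
  qed
  then show ?thesis
    unfolding flattening_def permsD(1)[OF assms]
    using permsD(1)[OF assms] by (intro map_idI) blast
qed

text \<open>The inner flattening relabels by ranks in the whole of \<open>xs\<close>, a strictly
  increasing map, and \<open>flattening_map\<close> makes such a relabelling invisible to the outer
  one.\<close>

lemma flattening_take_flattening:
  "flattening (take k (flattening xs)) = flattening (take k xs)"
proof -
  have "strict_mono_on (set (take k xs)) (\<lambda>x. card {y \<in> set xs. y \<le> x})"
    using strict_mono_on_rank[of "set xs"] set_take_subset[of k xs]
    by (auto intro: monotone_on_subset)
  from flattening_map[OF this] show ?thesis
    by (simp add: flattening_def take_map)
qed

text \<open>Ranks depend only on the underlying set, so both flattenings apply the same injective
  map, which can be cancelled.\<close>

lemma flattening_inj: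
  assumes "set xs = set ys" and "flattening xs = flattening ys"
  shows "xs = ys"
proof -
  have "inj_on (\<lambda>x. card {y \<in> set ys. y \<le> x}) (set xs \<union> set ys)"
    using strict_mono_on_imp_inj_on[OF strict_mono_on_rank[of "set ys"]] assms(1) by simp
  moreover have "map (\<lambda>x. card {y \<in> set ys. y \<le> x}) xs = map (\<lambda>x. card {y \<in> set ys. y \<le> x}) ys"
    using assms(2) unfolding flattening_def assms(1) .
  ultimately show ?thesis by (metis map_inj_on)
qed

text \<open>Supplies the inverse of flattening: \<open>g\<close> realizes a pattern on a prescribed
  set of values. The index starts at 1 to match the values of a pattern.\<close>

lemma ex_strict_mono_enumeration:
  fixes S :: "nat set"
  assumes "finite S"
  obtains g where "strict_mono_on {1..card S} g" "g ` {1..card S} = S"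
proof -
  obtain h where h: "bij_betw h {..<card S} S" "strict_mono_on {..<card S} h"
    using ex_bij_betw_strict_mono_card[OF assms] by metis
  have "strict_mono_on {1..card S} (\<lambda>i. h (i - 1))"
  proof (rule strict_mono_onI)
    fix r s assume "r \<in> {1..card S}" "s \<in> {1..card S}" "r < s"
    then show "h (r - 1) < h (s - 1)" by (intro strict_mono_onD[OF h(2)]) auto
  qed
  moreover have "(\<lambda>i. h (i - 1)) ` {1..card S} = S"
  proof -
    have "(\<lambda>i. i - 1) ` {1..card S} = {..<card S}"
      by (force simp: image_iff intro: bexI[of _ "Suc _"])
    then show ?thesis
      using h(1) by (metis bij_betw_imp_surj_on image_image)
  qed
  ultimately show ?thesis using that by blast
qed

section \<open>The J-statistic as a minimum, and left-to-right maxima\<close>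

text \<open>Entries below the minimum of the positions beyond \<open>I\<close> can only lie in the
  first \<open>I\<close> positions, hence to its left, so it is a bottom-to-top maximum. Any earlier
  position beyond \<open>I\<close> has this smaller entry to its right and fails.\<close>

lemma J_stat_eq_Min:
  assumes "distinct \<pi>" and "I < length \<pi>"
  shows "J_stat I \<pi> = Min (set (drop I \<pi>))"
proof -
  let ?m = "Min (set (drop I \<pi>))"
  have "?m \<in> set (drop I \<pi>)" using assms(2) by (intro Min_in) auto
  then obtain n0 where "n0 < length (drop I \<pi>)" "drop I \<pi> ! n0 = ?m"
    by (auto simp: in_set_conv_nth)
  then obtain n where n: "I \<le> n" "n < length \<pi>" "\<pi> ! n = ?m"
    using that[of "I + n0"] by auto
  have le: "?m \<le> \<pi> ! l" if "I \<le> l" "l < length \<pi>" for l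
  proof -
    have "\<pi> ! l = drop I \<pi> ! (l - I)" "l - I < length (drop I \<pi>)" using that by auto
    then show ?thesis by (metis Min_le List.finite_set nth_mem)
  qed
  have "(LEAST i. I < i \<and> btt_max_at \<pi> i) = n + 1"
  proof (rule Least_equality)
    have "l < n + 1" if "l \<in> {1..length \<pi>}" "entry \<pi> l < \<pi> ! n" for l
    proof (rule ccontr)
      assume "\<not> l < n + 1"
      with that n have "I \<le> l - 1" "l - 1 < length \<pi>" by auto
      from le[OF this] that(2) show False unfolding n(3) by linarith
    qed
    then show "I < n + 1 \<and> btt_max_at \<pi> (n + 1)"
      using n by (auto simp: btt_max_at_def)
  next
    fix i assume i: "I < i \<and> btt_max_at \<pi> i"
    then have il: "I \<le> i - 1" "i - 1 < length \<pi>" by (auto simp: btt_max_at_def)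
    show "n + 1 \<le> i"
    proof (rule ccontr)
      assume "\<not> n + 1 \<le> i"
      moreover from this have "\<pi> ! (i - 1) \<noteq> \<pi> ! n"
        using assms(1) n il i by (subst nth_eq_iff_index_eq) auto
      with le[OF il] n have "entry \<pi> (n + 1) < entry \<pi> i" by simp
      then have "n + 1 < i" using i n by (auto simp: btt_max_at_def)
      ultimately show False by simp
    qed
  qed
  then show ?thesis using n by (simp add: J_stat_def)
qed

text \<open>The earlier entries matter only as a set. This form survives a rearrangement of the
  prefix.\<close>

lemma ltr_max_at_iff:
  assumes "i \<in> {1..length \<pi>}"
  shows "ltr_max_at \<pi> i \<longleftrightarrow> (\<forall>x \<in> set (take (i - 1) \<pi>). x < entry \<pi> i)"
proof
  assume "ltr_max_at \<pi> i"
  then show "\<forall>x \<in> set (take (i - 1) \<pi>). x < entry \<pi> i"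
    using assms by (force simp: ltr_max_at_def in_set_conv_nth dest: bspec[of _ _ "Suc _"])
next
  assume *: "\<forall>x \<in> set (take (i - 1) \<pi>). x < entry \<pi> i"
  have "entry \<pi> l < entry \<pi> i" if "l \<in> {1..length \<pi>}" "l < i" for l
  proof -
    have "take (i - 1) \<pi> ! (l - 1) \<in> set (take (i - 1) \<pi>)"
      using that assms by (intro nth_mem) auto
    then show ?thesis using * that by auto
  qed
  then show "ltr_max_at \<pi> i" using assms by (auto simp: ltr_max_at_def)
qed

lemma Min_image_strict_mono_on:
  fixes f :: "nat \<Rightarrow> nat"
  assumes "strict_mono_on T f" "A \<subseteq> T" "finite A" "A \<noteq> {}"
  shows "Min (f ` A) = f (Min A)"
proof (rule Min_eqI)
  have "Min A \<in> A" using assms by simp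
  then show "f (Min A) \<in> f ` A" by simp
  fix y assume "y \<in> f ` A"
  then obtain a where "a \<in> A" "y = f a" by auto
  moreover have "Min A \<le> a" using \<open>a \<in> A\<close> assms by simp
  ultimately show "f (Min A) \<le> y"
    using strict_mono_on_less_eq[OF assms(1)] assms \<open>Min A \<in> A\<close> by blast
qed (use assms in auto)

section \<open>Independence of the counts from the chosen prefix\<close>

text \<open>
  Replacing the prefix pattern \<open>p\<close> by \<open>p'\<close> while keeping the set of values in the prefix and
  the whole suffix: this is why the counts depend on \<open>p\<close> only through its size and \<open>J\<close>-statistic.
\<close>

lemma card_prefix_le:
  assumes p: "p \<in> prefixes I k j" and p': "p' \<in> prefixes I k j"
    and kN: "k \<le> N" and IN: "I < N"
    and Q: "\<And>\<pi> \<pi>'. \<pi> \<in> perms N \<Longrightarrow> \<pi>' \<in> perms N \<Longrightarrow> flattening (take k \<pi>) = p \<Longrightarrow>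
      flattening (take k \<pi>') = p' \<Longrightarrow> set (take k \<pi>) = set (take k \<pi>') \<Longrightarrow>
      drop k \<pi> = drop k \<pi>' \<Longrightarrow> Q \<pi> \<Longrightarrow> Q' \<pi>'"
  shows "card {\<pi> \<in> perms N. flattening (take k \<pi>) = p \<and> Q \<pi> \<and> J_stat I \<pi> = J}
    \<le> card {\<pi> \<in> perms N. flattening (take k \<pi>) = p' \<and> Q' \<pi> \<and> J_stat I \<pi> = J}"
    (is "card ?A \<le> card ?B")
proof -
  have pp: "p \<in> perms k" "p' \<in> perms k" using p p' by (auto simp: prefixes_def)
  note pD = permsD[OF pp(1)] and p'D = permsD[OF pp(2)]
  have ex: "\<exists>\<pi>' \<in> ?B. set (take k \<pi>) = set (take k \<pi>') \<and> drop k \<pi> = drop k \<pi>'"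
    if A: "\<pi> \<in> ?A" for \<pi>
  proof -
    have \<pi>: "\<pi> \<in> perms N" "flattening (take k \<pi>) = p" "Q \<pi>" "J_stat I \<pi> = J"
      using A by auto
    note \<pi>D = permsD[OF \<pi>(1)]
    let ?S = "set (take k \<pi>)"
    have cS: "card ?S = k" using \<pi>D kN by (simp add: distinct_card)
    \<comment> \<open>\<open>g\<close> places a pattern on the values that \<open>\<pi>\<close> uses
      in its prefix, so \<open>take k \<pi>\<close> is \<open>map g p\<close>, and
      \<open>map g p'\<close> is the replacement prefix.\<close>
    obtain g where g: "strict_mono_on {1..k} g" "g ` {1..k} = ?S"
      using ex_strict_mono_enumeration[of ?S] cS by (metis List.finite_set)
    have inj: "inj_on g {1..k}" using strict_mono_on_imp_inj_on g by blast
    have fg: "flattening (map g q) = q" if "q \<in> perms k" for q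
      using flattening_map[of q g] flattening_perms[OF that] permsD(1)[OF that] g(1) by simp
    have tk: "take k \<pi> = map g p"
      by (rule flattening_inj) (simp_all only: set_map g(2) pD(1) \<pi>(2) fg[OF pp(1)])
    define \<pi>' where "\<pi>' = map g p' @ drop k \<pi>"
    have tk': "take k \<pi>' = map g p'" and dk': "drop k \<pi>' = drop k \<pi>"
      using p'D by (auto simp: \<pi>'_def)
    have S': "set (take k \<pi>') = ?S" using g p'D by (simp add: tk')
    have U: "?S \<union> set (drop k \<pi>) = {1..N}"
      using \<pi>D(1) by (metis append_take_drop_id set_append)
    have dis: "?S \<inter> set (drop k \<pi>) = {}"
      using \<pi>D(2) by (simp add: set_take_disj_set_drop_if_distinct)
    have P': "\<pi>' \<in> perms N"
    proof (rule permutations_of_setI)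
      show "set \<pi>' = {1..N}" using U S' by (simp add: \<pi>'_def p'D g)
      show "distinct \<pi>'"
        using dis g p'D inj \<pi>D by (simp add: \<pi>'_def distinct_map)
    qed
    note \<pi>'D = permsD[OF P']
    have f': "flattening (take k \<pi>') = p'"
      by (simp add: tk' fg[OF pp(2)])
    \<comment> \<open>If \<open>k \<le> I\<close>, the entries beyond \<open>I\<close> lie in the
      unchanged suffix. Otherwise the prefix contributes \<open>g (J_stat I p)\<close> to one
      minimum and \<open>g (J_stat I p')\<close> to the other, and these agree.\<close>
    have "Min (set (drop I \<pi>')) = Min (set (drop I \<pi>))"
    proof (cases "k \<le> I")
      case True
      then have "drop I \<pi>' = drop I \<pi>"
        using dk' by (metis drop_drop le_add_diff_inverse2)
      then show ?thesis by simp
    next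
      case False
      have Mg: "Min (set (drop I (map g q))) = g (J_stat I q)" "set (drop I (map g q)) \<noteq> {}"
        if "q \<in> perms k" for q
        using that False J_stat_eq_Min[of q I] permsD[OF that] set_drop_subset[of I q]
        by (auto simp: drop_map intro!: Min_image_strict_mono_on[OF g(1)])
      have d: "drop I (xs @ drop k \<pi>) = drop I xs @ drop k \<pi>" if "length xs = k" for xs
        using that False by simp
      have d1: "drop I \<pi> = drop I (map g p) @ drop k \<pi>"
        by (metis d[of "map g p"] tk pD(3) length_map append_take_drop_id)
      have d2: "drop I \<pi>' = drop I (map g p') @ drop k \<pi>"
        using d[of "map g p'"] p'D by (simp add: \<pi>'_def)
      have "J_stat I p = J_stat I p'" using p p' False by (simp add: prefixes_def)
      then have M: "Min (set (drop I (map g p))) = Min (set (drop I (map g p')))"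
        using Mg pp by simp
      show ?thesis
      proof (cases "drop k \<pi> = []")
        case True
        then show ?thesis using M d1 d2 by simp
      next
        case False
        then show ?thesis using M Mg(2)[OF pp(1)] Mg(2)[OF pp(2)]
          unfolding d1 d2 set_append by (subst (1 2) Min_Un) auto
      qed
    qed
    then have "J_stat I \<pi>' = J"
      using J_stat_eq_Min \<pi>D \<pi>'D IN \<pi>(4) by simp
    moreover have "Q' \<pi>'"
      using Q[OF \<pi>(1) P' \<pi>(2) f' S'[symmetric] dk'[symmetric] \<pi>(3)] .
    ultimately have "\<pi>' \<in> ?B" using P' f' by simp
    with S'[symmetric] dk'[symmetric] show ?thesis by (intro bexI[of _ \<pi>'] conjI)
  qed
  then obtain G where G: "\<And>\<pi>. \<pi> \<in> ?A \<Longrightarrow> G \<pi> \<in> ?B \<and>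
      set (take k \<pi>) = set (take k (G \<pi>)) \<and> drop k \<pi> = drop k (G \<pi>)"
    using bchoice[of ?A "\<lambda>\<pi> \<pi>'. \<pi>' \<in> ?B \<and>
      set (take k \<pi>) = set (take k \<pi>') \<and> drop k \<pi> = drop k \<pi>'"] by blast
  \<comment> \<open>The image retains the suffix and the set of prefix values; together with the
    fixed pattern \<open>p\<close> these determine the original permutation.\<close>
  have "inj_on G ?A"
  proof (rule inj_onI)
    fix x y assume xy: "x \<in> ?A" "y \<in> ?A" "G x = G y"
    then have "set (take k x) = set (take k y)" "drop k x = drop k y"
      using G[OF xy(1)] G[OF xy(2)] by simp_all
    moreover have "flattening (take k x) = flattening (take k y)" using xy(1,2) by simp
    with calculation(1) have "take k x = take k y" by (rule flattening_inj)
    ultimately show "x = y" by (metis append_take_drop_id)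
  qed
  moreover have "G ` ?A \<subseteq> ?B" using G by blast
  moreover have "finite ?B" by (rule finite_subset[of _ "perms N"]) auto
  ultimately show ?thesis by (rule card_inj_on_le)
qed

text \<open>The condition on \<open>N\<close> involves only the suffix and, through left-to-right
  maxima, the set of values preceding each suffix position. The exchange of patterns preserves both.
  An inequality is enough, since \<open>p\<close> and \<open>p'\<close> may be swapped.\<close>

lemma card_rejectable_le:
  assumes p: "p \<in> prefixes I k j" and p': "p' \<in> prefixes I k j"
    and "1 \<le> k" "k \<le> N" and IN: "I < N"
  shows "card {\<pi>. rejectable N p \<pi> \<and> J_stat I \<pi> = J}
    \<le> card {\<pi>. rejectable N p' \<pi> \<and> J_stat I \<pi> = J}"
proof -
  define Q where "Q \<pi> \<longleftrightarrow> (\<exists>m. k < m \<and> m \<le> N \<and> entry \<pi> m = N \<and>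
    (\<forall>i. k < i \<and> i < m \<longrightarrow> \<not> ltr_max_at \<pi> i))" for \<pi>
  have l: "length p = k" "length p' = k"
    using p p' by (auto simp: prefixes_def permsD)
  have "Q \<pi>'" if *: "\<pi> \<in> perms N" "\<pi>' \<in> perms N" "set (take k \<pi>) = set (take k \<pi>')"
      "drop k \<pi> = drop k \<pi>'" "Q \<pi>" for \<pi> \<pi>'
  proof -
    have e: "entry \<pi> i = entry \<pi>' i" if "k < i" "i \<le> N" for i
    proof -
      have "drop k \<pi> ! (i - 1 - k) = drop k \<pi>' ! (i - 1 - k)" using * by simp
      then show ?thesis using that permsD[OF *(1)] permsD[OF *(2)] by simp
    qed
    have t: "set (take (i - 1) \<pi>) = set (take (i - 1) \<pi>')" if "k < i" for i
    proof -
      have "take (i - 1) \<rho> = take k \<rho> @ take (i - 1 - k) (drop k \<rho>)" for \<rho> :: "nat list"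
        using that take_add[of k "i - 1 - k" \<rho>] by simp
      then show ?thesis using * by (metis set_append)
    qed
    have "ltr_max_at \<pi> i = ltr_max_at \<pi>' i" if "k < i" "i \<le> N" for i
      using e[OF that] t[OF that(1)] that permsD[OF *(1)] permsD[OF *(2)]
      by (subst (1 2) ltr_max_at_iff) auto
    then show ?thesis using *(5) e unfolding Q_def
      by (metis less_imp_le order_le_less_trans le_trans)
  qed
  then have "card {\<pi> \<in> perms N. flattening (take k \<pi>) = p \<and> Q \<pi> \<and> J_stat I \<pi> = J}
    \<le> card {\<pi> \<in> perms N. flattening (take k \<pi>) = p' \<and> Q \<pi> \<and> J_stat I \<pi> = J}"
    by (intro card_prefix_le[OF p p' \<open>k \<le> N\<close> IN])
  then show ?thesis
    by (simp add: rejectable_def Q_def l conj_assoc)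
qed

text \<open>When the pattern ends in \<open>k\<close>, the entry in position \<open>k\<close> has
  full rank and is the maximum of the prefix values. The exchange keeps that set, hence also this
  entry.\<close>

lemma card_acceptable_le:
  assumes p: "p \<in> prefixes I k j" and p': "p' \<in> prefixes I k j"
    and k: "1 \<le> k" "k \<le> N" and IN: "I < N"
    and e: "entry p k = k" "entry p' k = k"
  shows "card {\<pi>. acceptable N p \<pi> \<and> J_stat I \<pi> = J}
    \<le> card {\<pi>. acceptable N p' \<pi> \<and> J_stat I \<pi> = J}"
proof -
  have pp: "p \<in> perms k" "p' \<in> perms k" using p p' by (auto simp: prefixes_def)
  have l: "length p = k" "length p' = k"
    using pp by (auto simp: permsD)
  have max: "entry \<pi> k = Max (set (take k \<pi>))"
    if "\<pi> \<in> perms N" "flattening (take k \<pi>) = q" "entry q k = k" for \<pi> q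
  proof -
    let ?S = "set (take k \<pi>)"
    have lt: "k - 1 < length (take k \<pi>)" using permsD[OF that(1)] k by simp
    have x: "entry \<pi> k \<in> ?S" using nth_mem[OF lt] k by simp
    have "card {y \<in> ?S. y \<le> entry \<pi> k} = k"
      using that(2,3) lt k by (auto simp: flattening_def)
    moreover have "card ?S = k" using permsD[OF that(1)] k by (simp add: distinct_card)
    ultimately have "{y \<in> ?S. y \<le> entry \<pi> k} = ?S"
      by (intro card_subset_eq) auto
    then show ?thesis using x by (intro Max_eqI[symmetric]) auto
  qed
  have "entry \<pi>' k = N" if "\<pi> \<in> perms N" "\<pi>' \<in> perms N" "flattening (take k \<pi>) = p"
      "flattening (take k \<pi>') = p'" "set (take k \<pi>) = set (take k \<pi>')" "entry \<pi> k = N" for \<pi> \<pi>'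
    using max that e by metis
  then have "card {\<pi> \<in> perms N. flattening (take k \<pi>) = p \<and> entry \<pi> k = N \<and> J_stat I \<pi> = J}
    \<le> card {\<pi> \<in> perms N. flattening (take k \<pi>) = p' \<and> entry \<pi> k = N \<and> J_stat I \<pi> = J}"
    by (intro card_prefix_le[OF p p' \<open>k \<le> N\<close> IN])
  then show ?thesis
    by (simp add: acceptable_def l conj_assoc)
qed

text \<open>Inequalities in both directions make the count constant over the eligible prefixes, and
  \<open>p\<close> witnesses that only one number can be this constant, so the \<open>THE\<close> in
  \<open>tau\<close> denotes it.\<close>

lemma card_rejectable_eq_tau:
  assumes "p \<in> prefixes I k j" "1 \<le> k" "k \<le> N" "I < N"
  shows "card {\<pi>. rejectable N p \<pi> \<and> J_stat I \<pi> = J} = tau I N J k j"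
  unfolding tau_def
proof (rule the_equality[symmetric])
  show "\<forall>q \<in> prefixes I k j. card {\<pi>. rejectable N q \<pi> \<and> J_stat I \<pi> = J} =
      card {\<pi>. rejectable N p \<pi> \<and> J_stat I \<pi> = J}"
    using assms by (intro ballI le_antisym card_rejectable_le) auto
qed (use assms(1) in metis)

lemma card_acceptable_eq_sigma:
  assumes "p \<in> prefixes I k j" "entry p k = k" "1 \<le> k" "k \<le> N" "I < N"
  shows "card {\<pi>. acceptable N p \<pi> \<and> J_stat I \<pi> = J} = sigma I N J k j"
  unfolding sigma_def
proof (rule the_equality[symmetric])
  show "\<forall>q \<in> prefixes I k j. entry q k = k \<longrightarrow>
      card {\<pi>. acceptable N q \<pi> \<and> J_stat I \<pi> = J} =
      card {\<pi>. acceptable N p \<pi> \<and> J_stat I \<pi> = J}"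
    using assms by (intro ballI impI le_antisym card_acceptable_le) auto
qed (use assms(1,2) in metis)

section \<open>Extending a prefix pattern by one entry\<close>

text \<open>For \<open>p\<close> of size \<open>k\<close> and \<open>v\<close> in
  \<open>{1..k + 1}\<close>, this is the unique permutation of size \<open>k + 1\<close> that ends
  in \<open>v\<close> and whose first \<open>k\<close> entries flatten to \<open>p\<close>.\<close>

definition extend :: "nat list \<Rightarrow> nat \<Rightarrow> nat list" where
  "extend p v = map (\<lambda>x. if x < v then x else x + 1) p @ [v]"

lemma strict_mono_skip: "strict_mono_on A (\<lambda>x :: nat. if x < v then x else x + 1)"
  by (auto simp: strict_mono_on_def)

lemma extend_in_perms:
  assumes "p \<in> perms k" "v \<in> {1..k + 1}"
  shows "extend p v \<in> perms (k + 1)"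
proof (rule permutations_of_setI)
  note pD = permsD[OF assms(1)]
  have "x \<in> set (extend p v)" if "x \<in> {1..k + 1}" for x
  proof -
    consider "x < v" | "x = v" | "x > v" by linarith
    then show ?thesis
    proof cases
      case 1
      then have "x \<in> {1..k}" using that assms by auto
      with 1 show ?thesis using pD(1) by (auto simp: extend_def)
    next
      case 3
      then have "x - 1 \<in> {1..k}" "\<not> x - 1 < v" "x = x - 1 + 1" using that assms by auto
      then show ?thesis using pD(1) unfolding extend_def by (force simp: image_iff)
    qed (simp add: extend_def)
  qed
  moreover have "set (extend p v) \<subseteq> {1..k + 1}" using pD(1) assms by (auto simp: extend_def)
  ultimately show "set (extend p v) = {1..k + 1}" by blast
  show "distinct (extend p v)"
    using pD strict_mono_on_imp_inj_on[OF strict_mono_skip[of "set p" v]]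
    by (auto simp: extend_def distinct_map)
qed

text \<open>The first \<open>k\<close> entries of \<open>q\<close> and the shifted \<open>p\<close>
  have the same pattern and the same values, namely all but the last entry of \<open>q\<close>;
  \<open>flattening_inj\<close> identifies them.\<close>

lemma extend_eqI:
  assumes "q \<in> perms (k + 1)" and "flattening (take k q) = p"
  shows "q = extend p (q ! k)"
proof -
  note qD = permsD[OF assms(1)]
  let ?v = "q ! k"
  have q: "q = take k q @ [?v]"
    using qD(3) by (metis Suc_eq_plus1 lessI order_refl take_Suc_conv_app_nth take_all)
  have pk: "p \<in> perms k"
    using flattening_in_perms[of "take k q"] assms(2) qD by simp
  have v: "?v \<in> {1..k + 1}" using qD nth_mem[of k q] by simp
  have e: "extend p ?v \<in> perms (k + 1)" using extend_in_perms[OF pk v] .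
  have "set (take k q) = {1..k + 1} - {?v}"
  proof -
    have "?v \<notin> set (take k q)"
      using qD by (auto simp: in_set_conv_nth nth_eq_iff_index_eq)
    moreover have "insert ?v (set (take k q)) = {1..k + 1}"
      using arg_cong[OF q, of set] qD(1) by simp
    ultimately show ?thesis by blast
  qed
  moreover have "set (map (\<lambda>x. if x < ?v then x else x + 1) p) = {1..k + 1} - {?v}"
    using permsD[OF e] by (auto simp: extend_def)
  ultimately have "set (take k q) = set (map (\<lambda>x. if x < ?v then x else x + 1) p)"
    by (rule trans[OF _ sym])
  then have "take k q = map (\<lambda>x. if x < ?v then x else x + 1) p"
    by (rule flattening_inj)
      (simp only: flattening_map[OF strict_mono_skip] flattening_perms[OF pk] assms(2))
  then show ?thesis using q by (metis extend_def)
qed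

text \<open>The shift is harmless for the minimum: \<open>j < v\<close> stays \<open>j\<close>,
  while for \<open>j \<ge> v\<close> the new entry \<open>v\<close> lies below \<open>j + 1\<close>.
  For \<open>k = I\<close> only \<open>v\<close> lies beyond position \<open>I\<close>; for
  \<open>k < I\<close> the third argument of \<open>prefixes\<close> imposes nothing.\<close>

lemma extend_prefixes:
  assumes p: "p \<in> prefixes I k j" and v: "v \<in> {1..k + 1}"
  shows "extend p v \<in> prefixes I (k + 1) (if k = I then v else min v j)"
proof -
  have pk: "p \<in> perms k" using p by (simp add: prefixes_def)
  note pD = permsD[OF pk]
  note e = extend_in_perms[OF pk v]
  note eD = permsD[OF e]
  have "J_stat I (extend p v) = (if k = I then v else min v j)" if "I < k + 1"
  proof -
    let ?s = "\<lambda>x. if x < v then x else x + 1"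
    have J: "J_stat I (extend p v) = Min (set (drop I (extend p v)))"
      using J_stat_eq_Min eD that by simp
    have d: "drop I (extend p v) = map ?s (drop I p) @ [v]"
      using that pD by (simp add: extend_def drop_map)
    show ?thesis
    proof (cases "k = I")
      case True
      then show ?thesis using J d pD by simp
    next
      case False
      then have ne: "drop I p \<noteq> []" using pD that by simp
      have "Min (set (drop I p)) = j"
        using J_stat_eq_Min[of p I] p pD that False by (auto simp: prefixes_def)
      then have "Min (?s ` set (drop I p)) = ?s j"
        using Min_image_strict_mono_on[OF strict_mono_skip[of UNIV v], of "set (drop I p)"] ne
        by simp
      moreover have "Min (X \<union> {v}) = min (Min X) v" if "finite X" "X \<noteq> {}" for X
        using that by (subst Min_Un) auto
      then have "Min (set (drop I (extend p v))) = min (Min (?s ` set (drop I p))) v"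
        using ne by (simp only: d set_append set_map list.set finite_imageI List.finite_set
            image_is_empty set_empty not_False_eq_True)
      ultimately show ?thesis using J False by auto
    qed
  qed
  then show ?thesis using e by (simp add: prefixes_def)
qed

section \<open>Splitting the rejectable permutations by the next entry of the pattern\<close>

lemma rejectable_step:
  assumes \<pi>: "\<pi> \<in> perms N" and k: "1 \<le> k" "k < N"
    and q: "flattening (take (k + 1) \<pi>) = q" and p: "flattening (take k \<pi>) = p"
  shows "rejectable N p \<pi> \<longleftrightarrow> (if q ! k = k + 1 then acceptable N q \<pi> else rejectable N q \<pi>)"
proof -
  note D = permsD[OF \<pi>]
  have l: "length p = k" "length q = k + 1"
    using p q k D by (auto simp: flattening_def)
  let ?S = "set (take (k + 1) \<pi>)"
  have S: "?S = insert (\<pi> ! k) (set (take k \<pi>))"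
    using D k by (simp add: take_Suc_conv_app_nth)
  have nin: "\<pi> ! k \<notin> set (take k \<pi>)"
    using D k by (auto simp: in_set_conv_nth nth_eq_iff_index_eq)
  have "card ?S = k + 1" using D k by (simp add: distinct_card)
  moreover have "q ! k = card {y \<in> ?S. y \<le> \<pi> ! k}"
    using q k D by (auto simp: flattening_def)
  \<comment> \<open>\<open>q ! k\<close> is the rank of the entry of \<open>\<pi>\<close> in
    position \<open>k + 1\<close> among the first \<open>k + 1\<close> entries, so it is
    \<open>k + 1\<close> exactly at a left-to-right maximum.\<close>
  ultimately have "q ! k = k + 1 \<longleftrightarrow> {y \<in> ?S. y \<le> \<pi> ! k} = ?S"
    by (metis (no_types, lifting) List.finite_set card_subset_eq mem_Collect_eq subsetI)
  also have "\<dots> \<longleftrightarrow> (\<forall>x \<in> set (take k \<pi>). x < \<pi> ! k)"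
    using nin unfolding S by (auto simp: order_le_less)
  also have "\<dots> \<longleftrightarrow> ltr_max_at \<pi> (k + 1)"
    using k D by (subst ltr_max_at_iff) auto
  finally have last: "q ! k = k + 1 \<longleftrightarrow> ltr_max_at \<pi> (k + 1)" .
  \<comment> \<open>Needed contrapositively: if position \<open>k + 1\<close> is no left-to-right
    maximum, then \<open>N\<close> is not there.\<close>
  have top: "ltr_max_at \<pi> (k + 1)" if "\<pi> ! k = N"
  proof -
    have "x < \<pi> ! k" if "x \<in> set (take k \<pi>)" for x
      using that nin D(1) \<open>\<pi> ! k = N\<close> in_set_takeD[OF that] by (metis atLeastAtMost_iff order_le_less)
    then show ?thesis using k D by (subst ltr_max_at_iff) auto
  qed
  show ?thesis
  proof (cases "ltr_max_at \<pi> (k + 1)")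
    case True
    have "rejectable N p \<pi> \<longleftrightarrow> \<pi> ! k = N"
    proof
      assume "rejectable N p \<pi>"
      then obtain m where m: "k < m" "entry \<pi> m = N" "\<forall>i. k < i \<and> i < m \<longrightarrow> \<not> ltr_max_at \<pi> i"
        unfolding rejectable_def l by blast
      have "\<not> k + 1 < m" using m True by auto
      then have "m = k + 1" using m by simp
      then show "\<pi> ! k = N" using m by simp
    next
      assume "\<pi> ! k = N"
      then show "rejectable N p \<pi>"
        using \<pi> p k unfolding rejectable_def l by (auto intro!: exI[of _ "k + 1"])
    qed
    then show ?thesis using True last \<pi> q l by (simp add: acceptable_def)
  next
    case False
    \<comment> \<open>Position \<open>k + 1\<close> neither holds \<open>N\<close> nor is a
      left-to-right maximum, so moving the lower bound from \<open>k\<close> to \<open>k + 1\<close>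
      changes nothing.\<close>
    have "(k < m \<and> m \<le> N \<and> entry \<pi> m = N \<and> (\<forall>i. k < i \<and> i < m \<longrightarrow> \<not> ltr_max_at \<pi> i)) \<longleftrightarrow>
      (k + 1 < m \<and> m \<le> N \<and> entry \<pi> m = N \<and> (\<forall>i. k + 1 < i \<and> i < m \<longrightarrow> \<not> ltr_max_at \<pi> i))" for m
    proof -
      have "m \<noteq> k + 1" if "entry \<pi> m = N" using top False that by auto
      moreover have "i = k + 1 \<or> k + 1 < i" if "k < i" for i using that by auto
      ultimately show ?thesis
        using False by (metis Suc_eq_plus1 Suc_lessD)
    qed
    then show ?thesis using False last \<pi> q p l by (simp add: rejectable_def)
  qed
qed

lemma card_rejectable_rec:
  assumes p: "p \<in> perms k" and k: "1 \<le> k" "k < N"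
  shows "card {\<pi>. rejectable N p \<pi> \<and> J_stat I \<pi> = J} =
    card {\<pi>. acceptable N (extend p (k + 1)) \<pi> \<and> J_stat I \<pi> = J} +
    (\<Sum>v = 1..k. card {\<pi>. rejectable N (extend p v) \<pi> \<and> J_stat I \<pi> = J})"
proof -
  define R where "R v = {\<pi>. (if v = k + 1 then acceptable N (extend p v) \<pi> else rejectable N (extend p v) \<pi>)
    \<and> J_stat I \<pi> = J}" for v
  note pD = permsD[OF p]
  have le: "length (extend p v) = k + 1" "extend p v ! k = v" for v
    using pD by (auto simp: extend_def nth_append)
  have RD: "\<pi> \<in> perms N \<and> flattening (take (k + 1) \<pi>) = extend p v" if "\<pi> \<in> R v" for \<pi> v
    using that le(1) unfolding R_def by (auto simp: acceptable_def rejectable_def split: if_splits)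
  have "{\<pi>. rejectable N p \<pi> \<and> J_stat I \<pi> = J} = (\<Union>v\<in>{1..k + 1}. R v)"
  proof (intro set_eqI iffI)
    fix \<pi> assume "\<pi> \<in> {\<pi>. rejectable N p \<pi> \<and> J_stat I \<pi> = J}"
    then have *: "rejectable N p \<pi>" "J_stat I \<pi> = J" by auto
    then have \<pi>: "\<pi> \<in> perms N" "flattening (take k \<pi>) = p"
      using pD by (auto simp: rejectable_def)
    define q where "q = flattening (take (k + 1) \<pi>)"
    have q: "q \<in> perms (k + 1)"
      using flattening_in_perms[of "take (k + 1) \<pi>"] permsD[OF \<pi>(1)] k by (simp add: q_def)
    have "flattening (take k q) = p"
      using flattening_take_flattening[of k "take (k + 1) \<pi>"] \<pi>(2) by (simp add: q_def min_def)
    then have qe: "q = extend p (q ! k)" using extend_eqI q by blast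
    have "q ! k \<in> {1..k + 1}" using permsD[OF q] nth_mem[of k q] by simp
    moreover have "\<pi> \<in> R (q ! k)"
      using rejectable_step[OF \<pi>(1) k q_def[symmetric] \<pi>(2)] * qe unfolding R_def by auto
    ultimately show "\<pi> \<in> (\<Union>v\<in>{1..k + 1}. R v)" by blast
  next
    fix \<pi> assume "\<pi> \<in> (\<Union>v\<in>{1..k + 1}. R v)"
    then obtain v where v: "v \<in> {1..k + 1}" "\<pi> \<in> R v" by blast
    note \<pi> = RD[OF v(2)]
    have "flattening (take k \<pi>) = flattening (take k (extend p v))"
      using flattening_take_flattening[of k "take (k + 1) \<pi>"] \<pi> by (simp add: min_def)
    also have "\<dots> = p"
      using flattening_map[OF strict_mono_skip] flattening_perms[OF p] pD by (simp add: extend_def)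
    finally have "flattening (take k \<pi>) = p" .
    from rejectable_step[OF conjunct1[OF \<pi>] k conjunct2[OF \<pi>] this] v(2)
    show "\<pi> \<in> {\<pi>. rejectable N p \<pi> \<and> J_stat I \<pi> = J}"
      unfolding R_def le(2) mem_Collect_eq by blast
  qed
  moreover have "card (\<Union>v\<in>{1..k + 1}. R v) = (\<Sum>v = 1..k + 1. card (R v))"
  proof (rule card_UN_disjoint)
    show "\<forall>v\<in>{1..k + 1}. finite (R v)"
    proof
      fix v
      have "R v \<subseteq> perms N" using RD by blast
      then show "finite (R v)" by (rule finite_subset) simp
    qed
    \<comment> \<open>The pattern of the first \<open>k + 1\<close> entries is
      \<open>extend p v\<close>, whose last entry recovers \<open>v\<close>.\<close>
    show "\<forall>v\<in>{1..k + 1}. \<forall>w\<in>{1..k + 1}. v \<noteq> w \<longrightarrow> R v \<inter> R w = {}"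
      using RD le by (metis (no_types, lifting) disjoint_iff)
  qed simp
  moreover have "(\<Sum>v = 1..k + 1. card (R v)) = (\<Sum>v = 1..k. card (R v)) + card (R (k + 1))"
    by simp
  moreover have "(\<Sum>v = 1..k. card (R v)) =
      (\<Sum>v = 1..k. card {\<pi>. rejectable N (extend p v) \<pi> \<and> J_stat I \<pi> = J})"
    by (rule sum.cong) (auto simp: R_def)
  ultimately show ?thesis by (simp add: R_def)
qed

section \<open>Existence of prefixes and the recursion\<close>

text \<open>Without an eligible prefix the \<open>THE\<close> in \<open>tau\<close> would leave the
  value unspecified.\<close>

lemma prefixes_nonempty:
  assumes "I < k \<longrightarrow> j \<in> {1..I + 1}"
  shows "prefixes I k j \<noteq> {}"
proof (cases "I < k")
  case False
  have "[1..<k + 1] \<in> perms k" by (intro permutations_of_setI) auto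
  then show ?thesis using False by (auto simp: prefixes_def)
next
  case True
  then have j: "j \<in> {1..I + 1}" using assms by simp
  \<comment> \<open>The other values up to \<open>I + 1\<close> fill the first \<open>I\<close>
    positions, \<open>j\<close> takes position \<open>I + 1\<close>, and only larger values follow,
    so the minimum beyond \<open>I\<close> is \<open>j\<close>.\<close>
  define p where "p = ([1..<j] @ [j + 1..<I + 2]) @ j # [I + 2..<k + 1]"
  have p: "p \<in> perms k"
    using j True by (intro permutations_of_setI) (auto simp: p_def)
  have "length ([1..<j] @ [j + 1..<I + 2]) = I" using j by auto
  then have "drop I p = j # [I + 2..<k + 1]" by (simp add: p_def)
  then have "J_stat I p = Min (insert j {I + 2..<k + 1})"
    using J_stat_eq_Min[of p I] permsD[OF p] True by (simp del: upt_Suc)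
  also have "\<dots> = j" using j by (intro Min_eqI) auto
  finally show ?thesis using p by (auto simp: prefixes_def)
qed

text \<open>Each \<open>v < j\<close> contributes its own term, while the \<open>k - j + 1\<close>
  values \<open>v \<ge> j\<close> all contribute \<open>f j\<close>. This produces the coefficients
  of the recursion.\<close>

lemma sum_min:
  fixes f :: "nat \<Rightarrow> nat"
  assumes "1 \<le> j" "j \<le> k"
  shows "(\<Sum>v = 1..k. f (min v j)) = (k - j + 1) * f j + (\<Sum>i = 1..j - 1. f i)"
proof -
  have "{1..k} = {1..j - 1} \<union> {j..k}" using assms by auto
  then have "(\<Sum>v = 1..k. f (min v j)) = (\<Sum>v = 1..j - 1. f (min v j)) + (\<Sum>v = j..k. f (min v j))"
    using assms by (simp only:) (intro sum.union_disjoint, auto)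
  also have "(\<Sum>v = 1..j - 1. f (min v j)) = (\<Sum>v = 1..j - 1. f v)"
    by (rule sum.cong) (auto simp: min_def)
  also have "(\<Sum>v = j..k. f (min v j)) = (\<Sum>v = j..k. f j)"
    by (rule sum.cong) (auto simp: min_def)
  finally show ?thesis using assms by (simp add: Suc_diff_le)
qed

theorem lemma4p8:
  fixes I N J :: nat
  assumes "1 \<le> I" and "I < N" and "J \<in> {1..I + 1}"
  shows "(\<forall>j\<in>{1..I + 1}. tau I N J N j = 0) \<and>
    (\<forall>k j. 1 \<le> k \<and> k < N \<and> (if k > I then j \<in> {1..I + 1} else j = k) \<longrightarrow>
       tau I N J k j =
         B I N J k j + (k - j + 1) * tau I N J (k + 1) j + (\<Sum>i = 1..j - 1. tau I N J (k + 1) i))"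
proof (intro conjI ballI allI impI)
  fix j assume "j \<in> {1..I + 1}"
  then obtain p where p: "p \<in> prefixes I N j" using prefixes_nonempty by blast
  then have "length p = N" using permsD by (auto simp: prefixes_def)
  \<comment> \<open>A prefix of full length leaves no later position for the value
    \<open>N\<close>.\<close>
  then have "{\<pi>. rejectable N p \<pi> \<and> J_stat I \<pi> = J} = {}" by (auto simp: rejectable_def)
  then show "tau I N J N j = 0"
    using card_rejectable_eq_tau[OF p, of N J] assms by (simp only: card.empty)
next
  fix k j assume "1 \<le> k \<and> k < N \<and> (if k > I then j \<in> {1..I + 1} else j = k)"
  then have k: "1 \<le> k" "k < N" and j: "I < k \<longrightarrow> j \<in> {1..I + 1}" "\<not> I < k \<longrightarrow> j = k"
    by auto
  then have jk: "1 \<le> j" "j \<le> k" by (cases "I < k"; simp)+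
  obtain p where p: "p \<in> prefixes I k j" using prefixes_nonempty[OF j(1)] by blast
  then have pk: "p \<in> perms k" by (simp add: prefixes_def)
  have "card {\<pi>. rejectable N (extend p v) \<pi> \<and> J_stat I \<pi> = J} = tau I N J (k + 1) (min v j)"
    if "v \<in> {1..k}" for v
  proof -
    \<comment> \<open>For \<open>k = I\<close> the convention \<open>j = k\<close> gives
      \<open>min v j = v\<close>, so both cases of \<open>extend_prefixes\<close> take the same
      form.\<close>
    have "extend p v \<in> prefixes I (k + 1) (min v j)"
      using extend_prefixes[OF p, of v] that j by (auto simp: min_def split: if_splits)
    then show ?thesis using card_rejectable_eq_tau k assms by simp
  qed
  then have "(\<Sum>v = 1..k. card {\<pi>. rejectable N (extend p v) \<pi> \<and> J_stat I \<pi> = J}) =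
      (k - j + 1) * tau I N J (k + 1) j + (\<Sum>i = 1..j - 1. tau I N J (k + 1) i)"
    using sum_min[OF jk, of "tau I N J (k + 1)"] by simp
  moreover have "card {\<pi>. acceptable N (extend p (k + 1)) \<pi> \<and> J_stat I \<pi> = J} = B I N J k j"
  proof -
    have "entry (extend p (k + 1)) (k + 1) = k + 1"
      using permsD[OF pk] by (simp add: extend_def nth_append)
    \<comment> \<open>Since \<open>j \<le> k\<close>, appending a new maximum keeps the index
      \<open>j\<close>, except for \<open>k = I\<close>, where the new entry is the only one beyond
      \<open>I\<close>. This is the case distinction in \<open>B\<close>.\<close>
    moreover have "extend p (k + 1) \<in> prefixes I (k + 1) (if k = I then k + 1 else j)"
      using extend_prefixes[OF p, of "k + 1"] jk by (simp add: min_def split: if_splits)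
    ultimately show ?thesis
      using card_acceptable_eq_sigma[of "extend p (k + 1)" I "k + 1"] k assms by (simp add: B_def)
  qed
  ultimately show "tau I N J k j =
      B I N J k j + (k - j + 1) * tau I N J (k + 1) j + (\<Sum>i = 1..j - 1. tau I N J (k + 1) i)"
    using card_rejectable_rec[OF pk k, of I J]
      card_rejectable_eq_tau[OF p k(1) less_imp_le[OF k(2)] assms(2), of J]
    by linarith
qed

end
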